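(* Let $m\geq2$. Then $\mathbb{E}^{12\cdots m}(L_n)\sim m-1$ as $n\to\infty$, i.e. the expected length of a longest increasing subsequence of a uniformly random permutation in $S_n(312,12\cdots m)$ tends to $m-1$.
   Context: $S_n(312,\tau)$ is the set of permutations of $[n]$ avoiding both patterns $312$ and $\tau$; $12\cdots m$ is the increasing permutation of length $m$. $L_n(\sigma)$ is the length of a longest increasing subsequence of $\sigma$, and $\mathbb{E}^{\tau}$ denotes expectation under the uniform distribution on $S_n(312,\tau)$. $a_n\sim b_n$ means $a_n/b_n\to1$. *)

theory Defs
  imports
    "HOL-Probability.Probability"
    "HOL-Library.Sublist"
    "HOL-Library.Landau_Symbols"
    "HOL-Combinatorics.Multiset_Permutations"
begin

text \<open>
  Permutations of \<open>[n] = {1..n}\<close> and patterns are written in one-line notation, as lists of naturals.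
\<close>

definition order_isomorphic :: "nat list \<Rightarrow> nat list \<Rightarrow> bool" where
  "order_isomorphic xs ys \<longleftrightarrow>
     length xs = length ys \<and>
     (\<forall>i < length xs. \<forall>j < length xs. xs ! i < xs ! j \<longleftrightarrow> ys ! i < ys ! j)"

text \<open>
  \<^const>\<open>subseq\<close> selects entries at increasing, not necessarily adjacent, positions.
\<close>

definition contains_pattern :: "nat list \<Rightarrow> nat list \<Rightarrow> bool" where
  "contains_pattern \<sigma> \<tau> \<longleftrightarrow> (\<exists>xs. subseq xs \<sigma> \<and> order_isomorphic xs \<tau>)"

definition avoids :: "nat list \<Rightarrow> nat list \<Rightarrow> bool" where
  "avoids \<sigma> \<tau> \<longleftrightarrow> \<not> contains_pattern \<sigma> \<tau>"

definition S_av :: "nat \<Rightarrow> nat list \<Rightarrow> nat list \<Rightarrow> nat list set" where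
  "S_av n \<rho> \<tau> = {\<sigma> \<in> permutations_of_set {1..n}. avoids \<sigma> \<rho> \<and> avoids \<sigma> \<tau>}"

definition increasing_perm :: "nat \<Rightarrow> nat list" where
  "increasing_perm m = [1..<Suc m]"

definition lis_length :: "nat list \<Rightarrow> nat" where
  "lis_length \<sigma> = Max {length xs | xs. subseq xs \<sigma> \<and> sorted_wrt (<) xs}"

text \<open>
  \<^const>\<open>pmf_of_set\<close> is the uniform distribution only on a finite nonempty set. The set
  \<open>S_av n [3, 1, 2] \<tau>\<close> is always finite; for \<open>\<tau> = increasing_perm m\<close> with \<open>m \<ge> 2\<close> it is nonempty,
  since it contains the decreasing permutation.
\<close>

definition expected_lis :: "nat list \<Rightarrow> nat \<Rightarrow> real" where
  "expected_lis \<tau> n =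
     measure_pmf.expectation (pmf_of_set (S_av n [3, 1, 2] \<tau>)) (\<lambda>\<sigma>. real (lis_length \<sigma>))"

end

theory Submission
  imports Defs
begin

text \<open>
  A 312-avoiding permutation splits at its minimum as \<open>L @ [min] @ R\<close> with every entry of \<open>L\<close> below
  every entry of \<open>R\<close>, which identifies these permutations with binary trees; the longest increasing
  subsequence then has as many entries as the tree has nodes without a left child. The rotation
  \<open>Node (Node a Leaf) c \<mapsto> Node a (Node Leaf c)\<close>, performed somewhere in the tree, raises this number
  by one. A tree with \<open>n\<close> nodes, \<open>k\<close> of them without a left child, admits at least \<open>n + 1 - 2 * k\<close>
  such rotations, while a tree with \<open>k\<close> such nodes is the result of at most \<open>k\<close> of them. By double
  counting, all but a fraction \<open>O(1/n)\<close> of the trees with at most \<open>m - 1\<close> such nodes have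
  exactly \<open>m - 1\<close>.
\<close>

section \<open>Binary trees and 312-avoiding permutations\<close>

datatype shape = Leaf | Node shape shape

text \<open>A nonempty left subtree has \<open>ends l \<ge> 1\<close>, so \<open>max 1\<close> adds
  one exactly when the root has no left child: this counts the nodes without a left child.\<close>

fun ends :: "shape \<Rightarrow> nat" where
  "ends Leaf = 0"
| "ends (Node l r) = max 1 (ends l) + ends r"

text \<open>The nodes are numbered from \<open>a\<close> in preorder (root, left, right) and read in
  inorder, so the root carries the minimum and left labels lie below right labels.\<close>

fun perm_of :: "shape \<Rightarrow> nat \<Rightarrow> nat list" where
  "perm_of Leaf a = []"
| "perm_of (Node l r) a = perm_of l (Suc a) @ a # perm_of r (Suc a + size l)"

lemma ends_pos: "t \<noteq> Leaf \<Longrightarrow> ends t \<ge> 1"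
  by (cases t) auto

lemma length_perm_of [simp]: "length (perm_of t a) = size t"
  by (induction t arbitrary: a) auto

lemma set_perm_of [simp]: "set (perm_of t a) = {a..<a + size t}"
  by (induction t arbitrary: a) auto

lemma distinct_perm_of: "distinct (perm_of t a)"
  by (induction t arbitrary: a) auto

text \<open>The minimum \<open>a\<close> occurs only once, so it marks the root and both subtrees
  can be read off.\<close>

lemma perm_of_inject: "perm_of s a = perm_of t a \<Longrightarrow> s = t"
proof (induction s arbitrary: t a)
  case Leaf
  then show ?case by (cases t) auto
next
  case (Node l r)
  then obtain l' r' where t: "t = Node l' r'" by (cases t) auto
  have "perm_of l (Suc a) @ a # perm_of r (Suc a + size l) =
        perm_of l' (Suc a) @ a # perm_of r' (Suc a + size l')"
    using Node.prems t by simp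
  then have l: "perm_of l (Suc a) = perm_of l' (Suc a)"
    and r: "perm_of r (Suc a + size l) = perm_of r' (Suc a + size l')"
    by (subst (asm) append_Cons_eq_iff; simp)+
  from Node.IH(1)[OF l] r Node.IH(2) t show ?case by auto
qed

lemma subseq_imp_set_subset: "subseq xs ys \<Longrightarrow> set xs \<subseteq> set ys"
  by (induction rule: list_emb.induct) auto

lemma avoids_312_iff:
  "avoids \<sigma> [3, 1, 2] \<longleftrightarrow> \<not> (\<exists>x y z. subseq [x, y, z] \<sigma> \<and> y < z \<and> z < x)"
proof -
  have iso: "order_isomorphic xs [3, 1, 2] \<longleftrightarrow> (\<exists>x y z. xs = [x, y, z] \<and> y < z \<and> z < x)" for xs
  proof
    assume iso3: "order_isomorphic xs [3, 1, 2]"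
    then have "length xs = 3" by (simp add: order_isomorphic_def)
    then obtain x y z where xs: "xs = [x, y, z]"
      by (auto simp: numeral_3_eq_3 length_Suc_conv)
    from iso3 have "\<forall>i < 3. \<forall>j < 3. xs ! i < xs ! j \<longleftrightarrow> [3, 1, 2::nat] ! i < [3, 1, 2] ! j"
      by (simp add: order_isomorphic_def xs)
    \<comment> \<open>These entries of the pattern give 1 < 2 and 2 < 3, which fix the order of all
      three.\<close>
    from this[rule_format, of 1 2] this[rule_format, of 2 0] xs
    show "\<exists>x y z. xs = [x, y, z] \<and> y < z \<and> z < x" by auto
  next
    assume "\<exists>x y z. xs = [x, y, z] \<and> y < z \<and> z < x"
    then show "order_isomorphic xs [3, 1, 2]"
      by (auto simp: order_isomorphic_def nth_Cons less_Suc_eq split: nat.splits)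
  qed
  show ?thesis
    unfolding avoids_def contains_pattern_def iso by blast
qed

text \<open>An entry of \<open>L\<close> above an entry of \<open>R\<close> forms 312 with the
  minimum \<open>a\<close> between them. Conversely, in an occurrence not inside \<open>L\<close> or
  \<open>R\<close>, \<open>a\<close> can only play the 1, so the 3 lies in \<open>L\<close> and the
  2 in \<open>R\<close>, against \<open>L\<close> being below \<open>R\<close>.\<close>

lemma avoids_312_split:
  assumes "\<forall>x\<in>set L. a < x" "\<forall>x\<in>set R. a < x" "distinct (L @ R)"
  shows "avoids (L @ a # R) [3, 1, 2] \<longleftrightarrow>
    avoids L [3, 1, 2] \<and> avoids R [3, 1, 2] \<and> (\<forall>x\<in>set L. \<forall>y\<in>set R. x < y)"
    (is "?lhs \<longleftrightarrow> ?rhs")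
proof
  assume lhs: ?lhs
  have "avoids L [3, 1, 2]" "avoids R [3, 1, 2]"
    using lhs unfolding avoids_312_iff
    by (meson list_emb_append2 list_emb_Cons subseq_order.trans subseq_rev_drop_many subseq_drop_many)+
  moreover have "x < y" if "x \<in> set L" "y \<in> set R" for x y
  proof (rule ccontr)
    assume "\<not> x < y"
    with that assms(3) have "y < x" by (metis disjoint_iff distinct_append linorder_neqE_nat)
    moreover have "subseq ([x] @ [a, y]) (L @ a # R)"
      by (rule list_emb_append_mono) (use that in \<open>simp_all add: subseq_singleton_left\<close>)
    moreover have "a < y" using assms(2) that by blast
    ultimately show False using lhs unfolding avoids_312_iff append.simps by blast
  qed
  ultimately show ?rhs by blast
next
  assume rhs: ?rhs
  show ?lhs
    unfolding avoids_312_iff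
  proof safe
    fix x y z assume sub: "subseq [x, y, z] (L @ a # R)" and lt: "y < z" "z < x"
    obtain us vs where uv: "[x, y, z] = us @ vs" "subseq us L" "subseq vs (a # R)"
      using sub by (auto elim: subseq_appendE)
    have mem: "set us \<subseteq> set L" "set vs \<subseteq> insert a (set R)"
      using uv(2,3) by (auto dest!: subseq_imp_set_subset)
    have "us = [] \<and> vs = [x, y, z] \<or> us = [x] \<and> vs = [y, z] \<or> us = [x, y] \<and> vs = [z]
      \<or> us = [x, y, z] \<and> vs = []"
      using uv(1) by (simp add: Cons_eq_append_conv) metis
    then consider "us = []" "vs = [x, y, z]" | "us = [x]" "vs = [y, z]" | "us = [x, y]" "vs = [z]"
      | "us = [x, y, z]" "vs = []" by blast
    then show False
    proof cases
      case 1
      show False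
      proof (cases "x = a")
        case True
        then show False using mem(2) 1 lt assms(2) by auto
      next
        case False
        then have "subseq [x, y, z] R" using uv(3) 1 by simp
        with rhs lt show False unfolding avoids_312_iff by blast
      qed
    next
      case 2
      with mem have "x \<in> set L" "y = a \<or> y \<in> set R" "z = a \<or> z \<in> set R" by auto
      with rhs lt assms(1,2) show False by (metis less_asym)
    next
      case 3
      with mem have "x \<in> set L" "y \<in> set L" "z = a \<or> z \<in> set R" by auto
      with rhs lt assms(1) show False by (metis less_asym)
    next
      case 4
      with uv(2) rhs lt show False unfolding avoids_312_iff by blast
    qed
  qed
qed

lemma avoids_312_perm_of: "avoids (perm_of t a) [3, 1, 2]"
proof (induction t arbitrary: a)
  case Leaf
  then show ?case by (simp add: avoids_312_iff del: One_nat_def)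
next
  case (Node l r)
  let ?L = "perm_of l (Suc a)" and ?R = "perm_of r (Suc a + size l)"
  have "avoids (?L @ a # ?R) [3, 1, 2]"
    by (subst avoids_312_split) (use Node.IH in \<open>auto simp: distinct_perm_of simp del: One_nat_def\<close>)
  then show ?case by simp
qed

text \<open>Turns the order condition of the split into the exact value sets of the two blocks, as
  the recursion on intervals requires.\<close>

lemma interval_split:
  fixes a b :: nat
  assumes "A \<union> B = {a..<b}" "\<forall>x\<in>A. \<forall>y\<in>B. x < y"
  shows "A = {a..<a + card A}" "B = {a + card A..<b}"
proof -
  have "\<exists>c. A = {a..<c} \<and> B = {c..<b} \<and> a \<le> c"
  proof (cases "B = {}")
    case True
    \<comment> \<open>\<open>max a b\<close> keeps the cut at or above \<open>a\<close> also when
      the interval is empty.\<close>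
    with assms show ?thesis by (cases "a \<le> b") (auto intro!: exI[of _ "max a b"])
  next
    case False
    have fin: "finite B" using assms(1) by (metis finite_Un finite_atLeastLessThan)
    define c where "c = Min B"
    have c: "c \<in> B" "\<forall>y\<in>B. c \<le> y" using False fin by (auto simp: c_def)
    have mem: "x \<in> A \<or> x \<in> B \<longleftrightarrow> a \<le> x \<and> x < b" for x
      using assms(1) by (metis Un_iff atLeastLessThan_iff)
    have "A = {a..<c}"
      using c assms(2) mem by (auto simp: set_eq_iff) (meson leD less_trans)+
    moreover have "B = {c..<b}"
      using c assms(2) mem by (auto simp: set_eq_iff) (meson leD le_trans)+
    moreover have "a \<le> c" using c mem by blast
    ultimately show ?thesis by blast
  qed
  then show "A = {a..<a + card A}" "B = {a + card A..<b}" by auto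
qed

text \<open>Cut at the minimum and recurse; the offset \<open>a\<close> is arbitrary because the two
  blocks are permutations of shifted intervals.\<close>

lemma perm_of_surj:
  assumes "\<sigma> \<in> permutations_of_set {a..<a + n}" "avoids \<sigma> [3, 1, 2]"
  shows "\<exists>t. size t = n \<and> perm_of t a = \<sigma>"
  using assms
proof (induction n arbitrary: a \<sigma> rule: less_induct)
  case (less n)
  have \<sigma>: "set \<sigma> = {a..<a + n}" "distinct \<sigma>"
    using less.prems(1) by (auto simp: permutations_of_set_def)
  show ?case
  proof (cases "n = 0")
    case True
    then show ?thesis using \<sigma> by (auto intro!: exI[of _ Leaf])
  next
    case False
    then have "a \<in> set \<sigma>" using \<sigma> by simp
    then obtain L R where LR: "\<sigma> = L @ a # R" by (auto simp: in_set_conv_decomp)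
    have un: "set L \<union> set R = {Suc a..<a + n}"
    proof -
      have "set L \<union> set R = set \<sigma> - {a}" using \<sigma>(2) unfolding LR by auto
      also have "\<dots> = {Suc a..<a + n}" unfolding \<sigma>(1) by auto
      finally show ?thesis .
    qed
    then have gt: "\<forall>x\<in>set L. a < x" "\<forall>x\<in>set R. a < x"
      by (metis Un_iff atLeastLessThan_iff Suc_le_eq)+
    have dist: "distinct L" "distinct R" "distinct (L @ R)" using \<sigma>(2) LR by auto
    from less.prems(2) avoids_312_split[OF gt dist(3)]
    have av: "avoids L [3, 1, 2]" "avoids R [3, 1, 2]" "\<forall>x\<in>set L. \<forall>y\<in>set R. x < y"
      unfolding LR by auto
    have len: "length L + length R + 1 = n"
      using \<sigma> LR distinct_card[OF \<sigma>(2)] by simp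
    have setL: "set L = {Suc a..<Suc a + length L}"
      and "set R = {Suc a + length L..<a + n}"
      using interval_split[OF un av(3)] dist by (simp_all add: distinct_card)
    moreover have "a + n = Suc a + length L + length R" using len by simp
    ultimately have setR: "set R = {Suc a + length L..<Suc a + length L + length R}" by metis
    have "length L < n" "length R < n" using len by auto
    obtain l where l: "size l = length L" "perm_of l (Suc a) = L"
      using less.IH[OF \<open>length L < n\<close>, of L "Suc a"] setL dist(1) av(1)
      by (auto simp: permutations_of_set_def)
    obtain r where r: "size r = length R" "perm_of r (Suc a + length L) = R"
      using less.IH[OF \<open>length R < n\<close>, of R "Suc a + length L"] setR dist(2) av(2)
      by (auto simp: permutations_of_set_def)
    have "size (Node l r) = n \<and> perm_of (Node l r) a = \<sigma>"
      using l r len LR by simp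
    then show ?thesis by blast
  qed
qed

section \<open>Longest increasing subsequences as node counts\<close>

text \<open>An increasing subsequence through the minimum \<open>a\<close> takes nothing from the
  left block, hence at most \<open>1 + ends r\<close> entries; any other is bounded by
  \<open>ends l + ends r\<close>.\<close>

lemma length_le_ends:
  assumes "subseq xs (perm_of t a)" "sorted_wrt (<) xs"
  shows "length xs \<le> ends t"
  using assms
proof (induction t arbitrary: a xs)
  case Leaf
  then show ?case by simp
next
  case (Node l r)
  let ?L = "perm_of l (Suc a)" and ?R = "perm_of r (Suc a + size l)"
  obtain us vs where uv: "xs = us @ vs" "subseq us ?L" "subseq vs (a # ?R)"
    using Node.prems(1) by (auto elim: subseq_appendE)
  have us: "length us \<le> ends l" using Node uv by (auto simp: sorted_wrt_append)
  show ?case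
  proof (cases "subseq vs ?R")
    case True
    then have "length vs \<le> ends r" using Node uv by (auto simp: sorted_wrt_append)
    with us uv show ?thesis by simp
  next
    case False
    with uv(3) obtain ws where ws: "vs = a # ws" "subseq ws ?R"
      by (cases vs) (auto split: if_splits)
    have "us = []"
    proof (rule ccontr)
      assume "us \<noteq> []"
      then obtain u where u: "u \<in> set us" by (cases us) auto
      then have "u < a" using Node.prems(2) uv ws by (auto simp: sorted_wrt_append)
      moreover have "u \<in> set ?L" using u subseq_imp_set_subset[OF uv(2)] by blast
      ultimately show False by simp
    qed
    moreover have "length ws \<le> ends r"
      using Node ws uv by (auto simp: sorted_wrt_append)
    ultimately show ?thesis using uv ws by simp
  qed
qed

text \<open>Join optimal choices from both blocks, or put \<open>a\<close> before the right one if
  the left block is empty.\<close>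

lemma ends_attained: "\<exists>xs. subseq xs (perm_of t a) \<and> sorted_wrt (<) xs \<and> length xs = ends t"
proof (induction t arbitrary: a)
  case Leaf
  then show ?case by simp
next
  case (Node l r)
  let ?L = "perm_of l (Suc a)" and ?R = "perm_of r (Suc a + size l)"
  obtain us where us: "subseq us ?L" "sorted_wrt (<) us" "length us = ends l"
    using Node.IH(1) by blast
  obtain vs where vs: "subseq vs ?R" "sorted_wrt (<) vs" "length vs = ends r"
    using Node.IH(2) by blast
  have vs_set: "set vs \<subseteq> set ?R" and us_set: "set us \<subseteq> set ?L"
    using us(1) vs(1) by (auto dest!: subseq_imp_set_subset)
  show ?case
  proof (cases "l = Leaf")
    case True
    then show ?thesis using vs vs_set by (intro exI[of _ "a # vs"]) auto
  next
    case False
    have "subseq (us @ vs) (?L @ a # ?R)"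
      using us(1) vs(1) by (intro list_emb_append_mono) auto
    moreover have "sorted_wrt (<) (us @ vs)"
      using us vs us_set vs_set by (fastforce simp: sorted_wrt_append)
    moreover have "length (us @ vs) = ends (Node l r)"
      using us vs ends_pos[OF False] by simp
    ultimately show ?thesis by (metis perm_of.simps(2))
  qed
qed

lemma lis_length_perm_of: "lis_length (perm_of t a) = ends t"
  unfolding lis_length_def
proof (rule Max_eqI)
  show "finite {length xs |xs. subseq xs (perm_of t a) \<and> sorted_wrt (<) xs}"
    by (rule finite_subset[of _ "{..ends t}"]) (auto dest: length_le_ends)
  show "ends t \<in> {length xs |xs. subseq xs (perm_of t a) \<and> sorted_wrt (<) xs}"
    using ends_attained[of t a] by force
  fix k assume "k \<in> {length xs |xs. subseq xs (perm_of t a) \<and> sorted_wrt (<) xs}"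
  then obtain xs where "k = length xs" "subseq xs (perm_of t a)" "sorted_wrt (<) xs" by blast
  then show "k \<le> ends t" using length_le_ends by simp
qed

section \<open>Avoiding the increasing pattern, and the bijection with trees\<close>

lemma order_isomorphic_increasing_iff:
  "order_isomorphic xs (increasing_perm m) \<longleftrightarrow> length xs = m \<and> sorted_wrt (<) xs"
proof -
  have nth: "increasing_perm m ! i = Suc i" if "i < m" for i
    using that by (simp add: increasing_perm_def del: upt_Suc)
  have len: "length (increasing_perm m) = m" by (simp add: increasing_perm_def)
  have sorted: "(\<forall>i<m. \<forall>j<m. (xs ! i < xs ! j) = (i < j)) \<longleftrightarrow> (\<forall>i j. i < j \<longrightarrow> j < m \<longrightarrow> xs ! i < xs ! j)"
    (is "?l \<longleftrightarrow> ?r")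
  proof
    assume r: ?r
    show ?l
    proof safe
      fix i j assume ij: "i < m" "j < m" "xs ! i < xs ! j"
      show "i < j"
      proof (rule ccontr)
        assume "\<not> i < j"
        then have "j < i \<or> j = i" by auto
        with r ij show False by (metis less_asym less_irrefl)
      qed
    qed (use r in blast)
  qed (use less_trans in blast)
  show ?thesis
  proof (cases "length xs = m")
    case True
    then have "order_isomorphic xs (increasing_perm m) \<longleftrightarrow> (\<forall>i<m. \<forall>j<m. (xs ! i < xs ! j) = (i < j))"
      by (simp add: order_isomorphic_def len nth)
    with True sorted show ?thesis by (simp add: sorted_wrt_iff_nth_less)
  qed (simp add: order_isomorphic_def len)
qed

lemma avoids_increasing_perm_of:
  "avoids (perm_of t a) (increasing_perm m) \<longleftrightarrow> ends t < m"
proof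
  assume av: "avoids (perm_of t a) (increasing_perm m)"
  obtain xs where xs: "subseq xs (perm_of t a)" "sorted_wrt (<) xs" "length xs = ends t"
    using ends_attained by blast
  show "ends t < m"
  proof (rule ccontr)
    assume "\<not> ends t < m"
    \<comment> \<open>A longer increasing subsequence is cut down to its first \<open>m\<close>
      entries.\<close>
    then have "length (take m xs) = m" "subseq (take m xs) (perm_of t a)" "sorted_wrt (<) (take m xs)"
      using xs by (auto simp: sorted_wrt_take intro: subseq_order.trans prefix_imp_subseq take_is_prefix)
    with av show False
      unfolding avoids_def contains_pattern_def order_isomorphic_increasing_iff by blast
  qed
next
  assume "ends t < m"
  then show "avoids (perm_of t a) (increasing_perm m)"
    unfolding avoids_def contains_pattern_def order_isomorphic_increasing_iff
    using length_le_ends by fastforce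
qed

text \<open>Turns the average over permutations into an average over trees.\<close>

lemma bij_betw_perm_of:
  "bij_betw (\<lambda>t. perm_of t 1) {t. size t = n \<and> ends t < m} (S_av n [3, 1, 2] (increasing_perm m))"
  unfolding bij_betw_def
proof
  show "inj_on (\<lambda>t. perm_of t 1) {t. size t = n \<and> ends t < m}"
    by (auto intro: inj_onI dest: perm_of_inject)
  have Icc: "{1..n} = {1..<1 + n}" by auto
  show "(\<lambda>t. perm_of t 1) ` {t. size t = n \<and> ends t < m} = S_av n [3, 1, 2] (increasing_perm m)"
  proof (intro equalityI subsetI)
    fix \<sigma> assume "\<sigma> \<in> S_av n [3, 1, 2] (increasing_perm m)"
    then have \<sigma>: "\<sigma> \<in> permutations_of_set {1..<1 + n}" "avoids \<sigma> [3, 1, 2]"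
      "avoids \<sigma> (increasing_perm m)"
      unfolding S_av_def Icc by auto
    obtain t where "size t = n" "perm_of t 1 = \<sigma>"
      using perm_of_surj[OF \<sigma>(1,2)] by auto
    with \<sigma>(3) show "\<sigma> \<in> (\<lambda>t. perm_of t 1) ` {t. size t = n \<and> ends t < m}"
      by (auto simp: avoids_increasing_perm_of)
  next
    fix \<sigma> assume "\<sigma> \<in> (\<lambda>t. perm_of t 1) ` {t. size t = n \<and> ends t < m}"
    then obtain t where t: "\<sigma> = perm_of t 1" "size t = n" "ends t < m" by auto
    then have "\<sigma> \<in> permutations_of_set {1..n}"
      by (intro permutations_of_setI) (auto simp: distinct_perm_of)
    with t show "\<sigma> \<in> S_av n [3, 1, 2] (increasing_perm m)"
      unfolding S_av_def by (simp add: avoids_312_perm_of avoids_increasing_perm_of del: One_nat_def)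
  qed
qed

lemma finite_shapes: "finite {t :: shape. size t = n}"
proof (rule inj_on_finite[of "\<lambda>t. perm_of t 0" _ "permutations_of_set {0..<n}"])
  show "inj_on (\<lambda>t. perm_of t 0) {t. size t = n}"
    by (auto intro: inj_onI dest: perm_of_inject)
  show "(\<lambda>t. perm_of t 0) ` {t. size t = n} \<subseteq> permutations_of_set {0..<n}"
    by (auto simp: permutations_of_set_def distinct_perm_of)
  show "finite (permutations_of_set {0..<n})" by simp
qed

text \<open>Left combs: their permutations are the decreasing ones.\<close>

lemma shape_exists: "\<exists>t. size t = n \<and> ends t \<le> 1"
proof (induction n)
  case 0
  show ?case by (rule exI[of _ Leaf]) simp
next
  case (Suc n)
  then obtain t where "size t = n" "ends t \<le> 1" by blast
  then show ?case by (intro exI[of _ "Node t Leaf"]) auto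
qed

section \<open>Rotations and their inverses\<close>

text \<open>In a right rotation from \<open>Node (Node a b) c\<close> to
  \<open>Node a (Node b c)\<close> only the old root can lose its left child, and it does so exactly
  for \<open>b = Leaf\<close>; just these rotations are kept.\<close>

fun top_rot :: "shape \<Rightarrow> shape set" where
  "top_rot (Node (Node a Leaf) c) = {Node a (Node Leaf c)}"
| "top_rot _ = {}"

fun rot :: "shape \<Rightarrow> shape set" where
  "rot Leaf = {}"
| "rot (Node l r) = (\<lambda>l'. Node l' r) ` rot l \<union> Node l ` rot r \<union> top_rot (Node l r)"

fun top_unrot :: "shape \<Rightarrow> shape set" where
  "top_unrot (Node a (Node Leaf c)) = {Node (Node a Leaf) c}"
| "top_unrot _ = {}"

fun unrot :: "shape \<Rightarrow> shape set" where
  "unrot Leaf = {}"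
| "unrot (Node l r) = (\<lambda>l'. Node l' r) ` unrot l \<union> Node l ` unrot r \<union> top_unrot (Node l r)"

lemma top_rot_iff: "s \<in> top_rot t \<longleftrightarrow> (\<exists>a c. t = Node (Node a Leaf) c \<and> s = Node a (Node Leaf c))"
  by (cases t rule: top_rot.cases) auto

lemma top_unrot_iff: "t \<in> top_unrot s \<longleftrightarrow> (\<exists>a c. t = Node (Node a Leaf) c \<and> s = Node a (Node Leaf c))"
  by (cases s rule: top_unrot.cases) auto

lemma size_rot: "s \<in> rot t \<Longrightarrow> size s = size t"
proof (induction t arbitrary: s)
  case (Node l r)
  then show ?case by (auto simp only: rot.simps top_rot_iff Un_iff image_iff shape.inject shape.size)
qed simp

lemma ends_rot: "s \<in> rot t \<Longrightarrow> ends s = Suc (ends t)"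
proof (induction t arbitrary: s)
  case (Node l r)
  \<comment> \<open>Only a nonempty \<open>l\<close> can be rotated, so \<open>max 1\<close> does
    not swallow the gain of one.\<close>
  have "l \<noteq> Leaf" if "l' \<in> rot l" for l' using that by auto
  with Node show ?case
    using ends_pos[of l] by (fastforce simp: top_rot_iff simp del: top_rot.simps)
qed simp

lemma unrot_rot: "s \<in> rot t \<Longrightarrow> t \<in> unrot s"
proof (induction t arbitrary: s)
  case (Node l r)
  then consider l' where "s = Node l' r" "l' \<in> rot l" | r' where "s = Node l r'" "r' \<in> rot r"
    | "s \<in> top_rot (Node l r)" by auto
  then show ?case
  proof cases
    case 3
    then have "Node l r \<in> top_unrot s" by (simp only: top_rot_iff top_unrot_iff)
    then show ?thesis by (cases s) auto
  qed (use Node.IH in auto)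
qed simp

lemma finite_rot: "finite (rot t)"
proof (induction t)
  case (Node l r)
  have "finite (top_rot (Node l r))" by (cases "Node l r" rule: top_rot.cases) auto
  with Node show ?case by simp
qed simp

lemma finite_unrot: "finite (unrot t)"
proof (induction t)
  case (Node l r)
  have "finite (top_unrot (Node l r))" by (cases "Node l r" rule: top_unrot.cases) auto
  with Node show ?case by simp
qed simp

text \<open>Different places give different trees: a rotation inside \<open>l\<close> or
  \<open>r\<close> keeps the size of the left subtree, one at the root shrinks it.\<close>

lemma card_rot_Node: "card (rot (Node l r)) = card (rot l) + card (rot r) + card (top_rot (Node l r))"
proof -
  let ?A = "(\<lambda>l'. Node l' r) ` rot l" and ?B = "Node l ` rot r" and ?C = "top_rot (Node l r)"
  have fin: "finite ?A" "finite ?B" "finite ?C"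
    using finite_rot[of "Node l r"] by auto
  \<comment> \<open>This separates a change on the left from a change on the right.\<close>
  have neq: "t \<notin> rot t" for t using ends_rot by fastforce
  have AB: "?A \<inter> ?B = {}" using neq by auto
  have C: "(?A \<union> ?B) \<inter> ?C = {}"
    by (auto simp: top_rot_iff simp del: top_rot.simps dest!: size_rot)
  have "card (?A \<union> ?B \<union> ?C) = card ?A + card ?B + card ?C"
    using fin AB C by (simp add: card_Un_disjoint)
  moreover have "card ?A = card (rot l)" "card ?B = card (rot r)"
    by (auto intro!: card_image inj_onI)
  ultimately show ?thesis by simp
qed

text \<open>In the induction a left child contributes a rotation exactly when it has no right child; the extra summand compensates otherwise.\<close>

lemma card_rot_ge:
  assumes "t \<noteq> Leaf"
  shows "card (rot t) + 2 * ends t \<ge> size t + 1 + (if \<exists>l a b. t = Node l (Node a b) then 1 else 0)"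
  using assms
proof (induction t)
  case (Node l r)
  have r: "card (rot r) + 2 * ends r \<ge> size r + (if r = Leaf then 0 else 1)"
    using Node.IH(2) by (cases r) auto
  have ex: "(\<exists>l' a b. Node l r = Node l' (Node a b)) \<longleftrightarrow> r \<noteq> Leaf"
    by (cases r) auto
  show ?case
  proof (cases l)
    case Leaf
    then show ?thesis using r unfolding card_rot_Node ex by auto
  next
    case (Node a b)
    then have "card (rot l) + card (top_rot (Node l r)) + 2 * ends l \<ge> size l + 2"
      using Node.IH(1) by (cases b) auto
    then show ?thesis using r ends_pos[of l] Node unfolding card_rot_Node ex by (auto simp: max_def)
  qed
qed simp

text \<open>An inverse rotation is determined by a right child that has no left child itself. Such
  nodes are counted by \<open>ends\<close>; in a nonempty tree the last node of the left spine is
  counted too, but is no right child.\<close>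

lemma card_unrot_le: "card (unrot t) \<le> ends t"
proof -
  \<comment> \<open>Strictness for a nonempty \<open>r\<close> pays for the inverse rotation at the
    root, which exists only if \<open>r \<noteq> Leaf\<close>.\<close>
  have "card (unrot t) \<le> ends t \<and> (t \<noteq> Leaf \<longrightarrow> card (unrot t) < ends t)"
  proof (induction t)
    case (Node l r)
    have "card (unrot (Node l r)) \<le> card (unrot l) + card (unrot r) + card (top_unrot (Node l r))"
    proof -
      have "card (unrot (Node l r)) \<le> card ((\<lambda>l'. Node l' r) ` unrot l) + card (Node l ` unrot r)
         + card (top_unrot (Node l r))"
        using card_Un_le[of "(\<lambda>l'. Node l' r) ` unrot l \<union> Node l ` unrot r" "top_unrot (Node l r)"]
          card_Un_le[of "(\<lambda>l'. Node l' r) ` unrot l" "Node l ` unrot r"] by simp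
      also have "\<dots> \<le> card (unrot l) + card (unrot r) + card (top_unrot (Node l r))"
        by (intro add_mono card_image_le finite_unrot) auto
      finally show ?thesis .
    qed
    moreover have "card (top_unrot (Node l r)) \<le> (if r = Leaf then 0 else 1)"
      by (cases "Node l r" rule: top_unrot.cases) auto
    ultimately show ?case
      using Node by (cases "l = Leaf"; cases "r = Leaf") auto
  qed simp
  then show ?thesis by blast
qed

section \<open>Double counting\<close>

text \<open>Pairs \<open>(t, s)\<close> with \<open>s \<in> rot t\<close> are counted from
  \<open>t\<close> by \<open>card_rot_ge\<close> and from \<open>s\<close> by
  \<open>card_unrot_le\<close>.\<close>

lemma card_few_ends:
  assumes "K \<ge> 1" "n \<ge> 1"
  shows "(n + 3 - 2 * K) * card {t. size t = n \<and> ends t < K} \<le> K * card {t. size t = n \<and> ends t \<le> K}"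
    (is "?N * card ?X \<le> K * card ?T")
proof -
  have fin: "finite ?X" "finite ?T"
    by (rule finite_subset[OF _ finite_shapes[of n]]; auto)+
  have "?N * card ?X \<le> (\<Sum>t\<in>?X. card (rot t))"
  proof -
    \<comment> \<open>With \<open>ends t \<le> K - 1\<close> the bound is
      \<open>n + 1 - 2 * (K - 1)\<close>, that is \<open>?N\<close>; for large \<open>K\<close>
      truncated subtraction makes \<open>?N\<close> zero.\<close>
    have "?N \<le> card (rot t)" if "t \<in> ?X" for t
    proof -
      have "t \<noteq> Leaf" using that assms by auto
      from card_rot_ge[OF this] have "card (rot t) + 2 * ends t \<ge> n + 1" using that by auto
      moreover have "Suc (ends t) \<le> K" using that by auto
      ultimately show ?thesis by linarith
    qed
    from sum_mono[of ?X "\<lambda>_. ?N", OF this] show ?thesis by (simp add: mult.commute)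
  qed
  also have "\<dots> = card (SIGMA t:?X. rot t)"
    using fin finite_rot by (simp add: card_SigmaI)
  \<comment> \<open>A rotation raises \<open>ends\<close> by one, from below \<open>K\<close> to at
    most \<open>K\<close>, so the swapped pair lies over \<open>?T\<close>.\<close>
  also have "\<dots> \<le> card (SIGMA s:?T. unrot s)"
  proof (rule card_inj_on_le[of "\<lambda>(t, s). (s, t)"])
    show "(\<lambda>(t, s). (s, t)) ` (SIGMA t:?X. rot t) \<subseteq> (SIGMA s:?T. unrot s)"
      using unrot_rot size_rot ends_rot by fastforce
  qed (use fin finite_unrot in \<open>auto intro: inj_onI\<close>)
  also have "\<dots> = (\<Sum>s\<in>?T. card (unrot s))"
    using fin finite_unrot by (simp add: card_SigmaI)
  also have "\<dots> \<le> (\<Sum>s\<in>?T. K)"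
    by (rule sum_mono) (use card_unrot_le le_trans in blast)
  finally show ?thesis by (simp add: mult.commute)
qed

section \<open>The expectation and its limit\<close>

lemma expected_lis_eq:
  assumes "m \<ge> 2"
  defines "T \<equiv> \<lambda>n. {t. size t = n \<and> ends t < m}"
  shows "expected_lis (increasing_perm m) n = (\<Sum>t\<in>T n. real (ends t)) / card (T n)"
proof -
  let ?S = "S_av n [3, 1, 2] (increasing_perm m)"
  have bij: "bij_betw (\<lambda>t. perm_of t 1) (T n) ?S"
    unfolding T_def by (rule bij_betw_perm_of)
  have "finite (T n)"
    unfolding T_def by (rule finite_subset[OF _ finite_shapes[of n]]) auto
  then have "finite ?S" using bij bij_betw_finite by blast
  \<comment> \<open>\<open>pmf_of_set\<close> is uniform only on a nonempty set; the left comb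
    supplies a member.\<close>
  moreover have "?S \<noteq> {}"
  proof -
    obtain t where "size t = n" "ends t \<le> 1" using shape_exists by blast
    then have "t \<in> T n" using assms by (auto simp: T_def)
    then show ?thesis using bij by (auto simp: bij_betw_def)
  qed
  ultimately have "expected_lis (increasing_perm m) n = (\<Sum>\<sigma>\<in>?S. real (lis_length \<sigma>)) / card ?S"
    unfolding expected_lis_def by (simp add: integral_pmf_of_set)
  also have "(\<Sum>\<sigma>\<in>?S. real (lis_length \<sigma>)) = (\<Sum>t\<in>T n. real (ends t))"
    using sum.reindex_bij_betw[OF bij, of "\<lambda>\<sigma>. real (lis_length \<sigma>)"]
    by (simp add: lis_length_perm_of)
  also have "card ?S = card (T n)" using bij_betw_same_card[OF bij] by simp
  finally show ?thesis .
qed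

text \<open>Only trees with fewer than \<open>m - 1\<close> ends fall short of \<open>m - 1\<close>,
  each by at most \<open>m\<close>, and \<open>card_few_ends\<close> bounds their share. The
  condition \<open>n \<ge> 2 * m\<close> keeps the denominator positive.\<close>

lemma expected_lis_bounds:
  assumes "m \<ge> 2" "n \<ge> 2 * m"
  shows "expected_lis (increasing_perm m) n \<le> real m - 1"
    and "real m - 1 - real m ^ 2 / (real n + 5 - 2 * real m) \<le> expected_lis (increasing_perm m) n"
proof -
  define T where "T = {t. size t = n \<and> ends t < m}"
  define X where "X = {t. size t = n \<and> ends t < m - 1}"
  have fin: "finite T"
    unfolding T_def by (rule finite_subset[OF _ finite_shapes[of n]]) auto
  have XT: "X \<subseteq> T" by (auto simp: X_def T_def)
  have "T \<noteq> {}" using shape_exists[of n] assms by (auto simp: T_def)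
  then have pos: "real (card T) > 0" using fin by (simp add: card_gt_0_iff)
  have E: "expected_lis (increasing_perm m) n = (\<Sum>t\<in>T. real (ends t)) / card T"
    unfolding T_def by (rule expected_lis_eq) fact
  have "(\<Sum>t\<in>T. real (ends t)) \<le> (\<Sum>t\<in>T. real m - 1)"
    by (rule sum_mono) (auto simp: T_def)
  then show "expected_lis (increasing_perm m) n \<le> real m - 1"
    unfolding E using pos by (simp add: divide_le_eq mult.commute)
  have T_alt: "T = {t. size t = n \<and> ends t \<le> m - 1}" using assms by (auto simp: T_def)
  \<comment> \<open>Here \<open>K = m - 1\<close>, at least 1 by \<open>m \<ge> 2\<close>. As
    \<open>n \<ge> 2 * m\<close>, the subtraction is exact and the factor is
    \<open>n + 5 - 2 * m\<close>.\<close>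
  have "(n + 3 - 2 * (m - 1)) * card X \<le> (m - 1) * card T"
    unfolding X_def T_alt using assms by (intro card_few_ends) auto
  then have "real ((n + 3 - 2 * (m - 1)) * card X) \<le> real ((m - 1) * card T)"
    by (simp only: of_nat_le_iff)
  moreover have "real (n + 3 - 2 * (m - 1)) = real n + 5 - 2 * real m" "real (m - 1) = real m - 1"
    using assms by (simp_all add: of_nat_diff)
  ultimately have cX: "(real n + 5 - 2 * real m) * card X \<le> (real m - 1) * card T"
    by (simp only: of_nat_mult)
  have "(real m - 1) * card T - (\<Sum>t\<in>T. real (ends t)) = (\<Sum>t\<in>T. real m - 1 - real (ends t))"
    by (simp add: sum_subtractf)
  also have "\<dots> = (\<Sum>t\<in>X. real m - 1 - real (ends t))"
    by (rule sum.mono_neutral_right) (use fin XT in \<open>auto simp: X_def T_def\<close>)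
  also have "\<dots> \<le> (\<Sum>t\<in>X. real m)" by (rule sum_mono) auto
  also have "\<dots> = real m * card X" by simp
  \<comment> \<open>The factor \<open>m - 1\<close> of \<open>cX\<close> is relaxed to
    \<open>m\<close>.\<close>
  also have "\<dots> \<le> real m * (real m * card T / (real n + 5 - 2 * real m))"
    using cX assms pos by (intro mult_left_mono) (auto simp: field_simps)
  finally show "real m - 1 - real m ^ 2 / (real n + 5 - 2 * real m) \<le> expected_lis (increasing_perm m) n"
    unfolding E using pos by (simp add: field_simps power2_eq_square)
qed

theorem theorem3p2:
  fixes m :: nat
  assumes "m \<ge> 2"
  shows "expected_lis (increasing_perm m) \<sim>[sequentially] (\<lambda>_. real m - 1)
       \<and> expected_lis (increasing_perm m) \<longlonglongrightarrow> real m - 1"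
proof -
  have "filterlim (\<lambda>n. real n + 5 - 2 * real m) at_top sequentially"
    using filterlim_tendsto_add_at_top[OF tendsto_const filterlim_real_sequentially, of "5 - 2 * real m"]
    by (simp add: algebra_simps)
  then have "(\<lambda>n. real m ^ 2 / (real n + 5 - 2 * real m)) \<longlonglongrightarrow> 0"
    by (intro tendsto_divide_0[OF tendsto_const] filterlim_at_top_imp_at_infinity)
  from tendsto_diff[OF tendsto_const this, of "real m - 1"]
  have lower: "(\<lambda>n. real m - 1 - real m ^ 2 / (real n + 5 - 2 * real m)) \<longlonglongrightarrow> real m - 1"
    by simp
  have lim: "expected_lis (increasing_perm m) \<longlonglongrightarrow> real m - 1"
  proof (rule tendsto_sandwich[OF _ _ lower tendsto_const])
    show "\<forall>\<^sub>F n in sequentially.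
        real m - 1 - real m ^ 2 / (real n + 5 - 2 * real m) \<le> expected_lis (increasing_perm m) n"
      by (rule eventually_sequentiallyI[of "2 * m"]) (rule expected_lis_bounds(2)[OF assms])
    show "\<forall>\<^sub>F n in sequentially. expected_lis (increasing_perm m) n \<le> real m - 1"
      by (rule eventually_sequentiallyI[of "2 * m"]) (rule expected_lis_bounds(1)[OF assms])
  qed
  moreover have "expected_lis (increasing_perm m) \<sim>[sequentially] (\<lambda>_. real m - 1)"
    \<comment> \<open>The quotient tends to 1, as \<open>m \<ge> 2\<close> makes
      \<open>m - 1\<close> nonzero.\<close>
    using tendsto_divide[OF lim tendsto_const, of "real m - 1"] assms
    by (intro asymp_equivI') simp
  ultimately show ?thesis by blast
qed

end
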